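(* Let $\varphi=\frac{1+\sqrt5}{2}$, $\tau=\frac{-1+\sqrt5}{2}$, and $$\rho=\varphi+\sqrt{\varphi},\qquad \omega=-\tau+\sqrt{\tau}\,i,\qquad\text{so that}\qquad \rho\,\omega=(1+\sqrt\tau)(-1+\sqrt\varphi\, i).$$ For $n\in\mathbb Z$ let $D_n$ be the disk in the complex plane $\mathbb C\cong\mathbb R^2$ with $$\text{radius } r_n=\rho^n\in\mathbb R,\qquad \text{center } z_n=(1+\rho)\,\frac{(\rho\omega)^n-1}{\rho\omega-1}\in\mathbb C .$$ Then for every $n\in\mathbb Z$ the quadruple of consecutive disks $(D_n,D_{n+1},D_{n+2},D_{n+3})$ forms a Descartes configuration. Moreover, there is an unbounded Apollonian packing that contains all the disks $D_n$, $n\in\mathbb Z$, and that fills the whole plane with disks of positive curvature.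
   Context: Generalized disks: a generalized disk in the plane (viewed in the Riemann sphere) is an ordinary closed disk (positive curvature $1/r$), a closed half-plane (curvature $0$; it contains the point $\infty$), or the closed exterior of a circle together with $\infty$ (negative radius and curvature). Two generalized disks are (externally) tangent if their interiors are disjoint and they meet in exactly one point of the sphere. Four generalized disks form a Descartes configuration if they are pairwise tangent. Apollonian packing: given three mutually tangent generalized disks (called a seed), the Apollonian packing they determine is the family of generalized disks obtained by recursively inscribing new disks in the curvilinear triangles between mutually tangent disks; i.e. the smallest family containing the seed such that, whenever three pairwise tangent members are given, both generalized disks tangent to all three also belong to the family. An Apollonian packing is called unbounded if for every $x\in\mathbb R$ it contains a disk with radius $r$ satisfying $x<r<\infty$. "Fills the whole plane with disks of positive curvature" means: every member of the packing is an ordinary disk (positive curvature), members have pairwise disjoint interiors, and their union is dense in the plane. *)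

theory Defs
  imports "HOL-Analysis.Analysis"
begin

text \<open>The Riemann sphere is the one-point compactification of the complex plane: the point
  \<open>Some z\<close> is the complex number \<open>z\<close>, and \<open>None\<close> is the point at infinity.\<close>

definition riemann_sphere :: "complex option topology" where
  "riemann_sphere = Alexandroff_compactification euclidean"

definition disk :: "complex \<Rightarrow> real \<Rightarrow> complex option set" where
  "disk c r = Some ` cball c r"

definition half_plane :: "complex \<Rightarrow> real \<Rightarrow> complex option set" where
  "half_plane a b = insert None (Some ` {z. a \<bullet> z \<le> b})"

definition exterior_disk :: "complex \<Rightarrow> real \<Rightarrow> complex option set" where
  "exterior_disk c r = insert None (Some ` (- ball c r))"

definition ordinary_disk :: "complex option set \<Rightarrow> bool" where
  "ordinary_disk D \<longleftrightarrow> (\<exists>c r. 0 < r \<and> D = disk c r)"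

definition generalized_disk :: "complex option set \<Rightarrow> bool" where
  "generalized_disk D \<longleftrightarrow>
     ordinary_disk D \<or>
     (\<exists>a b. a \<noteq> 0 \<and> D = half_plane a b) \<or>
     (\<exists>c r. 0 < r \<and> D = exterior_disk c r)"

text \<open>Only finite radii are recorded: a half-plane, whose radius is infinite, is related to no
  real number by \<open>has_radius\<close>.\<close>

inductive has_radius :: "complex option set \<Rightarrow> real \<Rightarrow> bool" where
  "0 < r \<Longrightarrow> has_radius (disk c r) r"
| "0 < r \<Longrightarrow> has_radius (exterior_disk c r) (- r)"

inductive has_curvature :: "complex option set \<Rightarrow> real \<Rightarrow> bool" where
  "has_radius D r \<Longrightarrow> has_curvature D (1 / r)"
| "a \<noteq> 0 \<Longrightarrow> has_curvature (half_plane a b) 0"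

lemma positive_curvature_iff_ordinary_disk:
  "(\<exists>k>0. has_curvature D k) \<longleftrightarrow> ordinary_disk D"
proof
  assume "\<exists>k>0. has_curvature D k"
  then show "ordinary_disk D"
    by (auto simp: ordinary_disk_def elim!: has_curvature.cases has_radius.cases)
next
  assume "ordinary_disk D"
  then obtain c r where "0 < r" "D = disk c r"
    unfolding ordinary_disk_def by blast
  then have "has_curvature D (1 / r)" "0 < 1 / r"
    by (auto intro: has_curvature.intros has_radius.intros)
  then show "\<exists>k>0. has_curvature D k" by blast
qed

definition tangent :: "complex option set \<Rightarrow> complex option set \<Rightarrow> bool" where
  "tangent D E \<longleftrightarrow>
     disjnt (riemann_sphere interior_of D) (riemann_sphere interior_of E) \<and>
     (\<exists>!p. p \<in> D \<inter> E)"

definition mutually_tangent ::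
  "complex option set \<Rightarrow> complex option set \<Rightarrow> complex option set \<Rightarrow> bool" where
  "mutually_tangent A B C \<longleftrightarrow> tangent A B \<and> tangent A C \<and> tangent B C"

definition descartes_configuration ::
  "complex option set \<Rightarrow> complex option set \<Rightarrow> complex option set \<Rightarrow> complex option set \<Rightarrow> bool" where
  "descartes_configuration A B C D \<longleftrightarrow>
     generalized_disk A \<and> generalized_disk B \<and> generalized_disk C \<and> generalized_disk D \<and>
     tangent A B \<and> tangent A C \<and> tangent A D \<and> tangent B C \<and> tangent B D \<and> tangent C D"

inductive_set packing_of_seed ::
  "complex option set \<Rightarrow> complex option set \<Rightarrow> complex option set \<Rightarrow> complex option set set"
  for A B C where
  seed1: "A \<in> packing_of_seed A B C"
| seed2: "B \<in> packing_of_seed A B C"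
| seed3: "C \<in> packing_of_seed A B C"
| inscribe:
    "\<lbrakk>D \<in> packing_of_seed A B C; E \<in> packing_of_seed A B C; F \<in> packing_of_seed A B C;
      mutually_tangent D E F;
      generalized_disk G; tangent G D; tangent G E; tangent G F\<rbrakk>
     \<Longrightarrow> G \<in> packing_of_seed A B C"

definition apollonian_packing :: "complex option set set \<Rightarrow> bool" where
  "apollonian_packing P \<longleftrightarrow>
     (\<exists>A B C. generalized_disk A \<and> generalized_disk B \<and> generalized_disk C \<and>
        mutually_tangent A B C \<and> P = packing_of_seed A B C)"

definition unbounded_packing :: "complex option set set \<Rightarrow> bool" where
  "unbounded_packing P \<longleftrightarrow> (\<forall>x. \<exists>D\<in>P. \<exists>r. has_radius D r \<and> x < r)"

definition fills_plane_with_positive_curvature :: "complex option set set \<Rightarrow> bool" where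
  "fills_plane_with_positive_curvature P \<longleftrightarrow>
     (\<forall>D\<in>P. \<exists>k>0. has_curvature D k) \<and>
     pairwise (\<lambda>D E. disjnt (riemann_sphere interior_of D) (riemann_sphere interior_of E)) P \<and>
     closure {z. Some z \<in> \<Union>P} = UNIV"

definition phi :: real where
  "phi = (1 + sqrt 5) / 2"

definition tau :: real where
  "tau = (- 1 + sqrt 5) / 2"

definition rho :: real where
  "rho = phi + sqrt phi"

definition omega :: complex where
  "omega = - of_real tau + of_real (sqrt tau) * \<i>"

definition spiral_radius :: "int \<Rightarrow> real" where
  "spiral_radius n = rho powi n"

definition spiral_center :: "int \<Rightarrow> complex" where
  "spiral_center n =
     (1 + of_real rho) * (((of_real rho * omega) powi n - 1) / (of_real rho * omega - 1))"

definition spiral_disk :: "int \<Rightarrow> complex option set" where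
  "spiral_disk n = disk (spiral_center n) (spiral_radius n)"

end

theory Submission
  imports Defs
begin

text \<open>A circle with centre \<open>c\<close> and signed radius \<open>r\<close> is encoded by the vector
  \<open>(1/r, c/r, (|c|\<^sup>2 - r\<^sup>2)/r)\<close> of Minkowski space. The negated Lorentz form takes the value \<open>1\<close> on
  externally tangent circles and is at least \<open>1\<close> exactly when two disks have disjoint interiors.
  A Descartes configuration is a basis with fixed Gram matrix, and the two disks tangent to three of
  its members differ by the swap \<open>Q i \<mapsto> 2 (sum of the others) - Q i\<close>. Expanding a vector \<open>v\<close> in this
  basis turns its norm into the Descartes equation for the products of \<open>v\<close> with the basis.

  Along reduced words of swaps these products increase, so any two disks of the orbit have disjoint
  interiors, and all curvatures are positive, because every member is reached from a late spiral
  quadruple through swaps that increase curvature. Conversely, swapping the member with the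
  largest product decreases the sum of the products by a fixed amount. For a disk missing the
  packing the products stay at least \<open>1\<close>, which is absurd, so the packing is dense. For the sum of
  three mutually tangent members the descent can only stop at a quadruple containing all three, so
  every inscribed disk comes from a swap.\<close>

section \<open>Circles as vectors of Minkowski space\<close>

definition inv_form :: "real \<times> complex \<times> real \<Rightarrow> real \<times> complex \<times> real \<Rightarrow> real" where
  "inv_form v w = (fst v * snd (snd w) + snd (snd v) * fst w) / 2 - fst (snd v) \<bullet> fst (snd w)"

lemma inv_form_commute: "inv_form v w = inv_form w v"
  by (simp add: inv_form_def inner_commute algebra_simps)

lemma bilinear_inv_form: "bilinear inv_form"
  unfolding bilinear_def inv_form_def
  by (auto intro!: linearI simp: algebra_simps inner_add_left inner_add_right add_divide_distrib diff_divide_distrib)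

lemmas inv_form_simps =
  bilinear_ladd[OF bilinear_inv_form] bilinear_radd[OF bilinear_inv_form]
  bilinear_lsub[OF bilinear_inv_form] bilinear_rsub[OF bilinear_inv_form]
  bilinear_lmul[OF bilinear_inv_form] bilinear_rmul[OF bilinear_inv_form]
  bilinear_lzero[OF bilinear_inv_form] bilinear_rzero[OF bilinear_inv_form]

lemma inv_form_sum_right: "inv_form v (sum f A) = (\<Sum>i\<in>A. inv_form v (f i))"
  by (rule linear_sum) (use bilinear_inv_form in \<open>auto simp only: bilinear_def\<close>)

lemma inv_form_sum_left: "inv_form (sum f A) v = (\<Sum>i\<in>A. inv_form (f i) v)"
  by (rule linear_sum[where f = "\<lambda>w. inv_form w v"]) (use bilinear_inv_form in \<open>auto simp only: bilinear_def\<close>)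

text \<open>The third entry is the curvature of the image of the circle under inversion in the unit
  circle. A negative \<open>r\<close> is meaningful too and encodes the exterior of a
  circle.\<close>

definition circle_vec :: "complex \<Rightarrow> real \<Rightarrow> real \<times> complex \<times> real" where
  "circle_vec c r = (1 / r, c /\<^sub>R r, ((norm c)\<^sup>2 - r\<^sup>2) / r)"

lemma fst_circle_vec: "fst (circle_vec c r) = 1 / r"
  by (simp add: circle_vec_def)

lemma inv_form_circle_vec:
  assumes "r \<noteq> 0" "s \<noteq> 0"
  shows "inv_form (circle_vec c r) (circle_vec d s) = ((dist c d)\<^sup>2 - r\<^sup>2 - s\<^sup>2) / (2 * r * s)"
  using assms
  by (simp add: inv_form_def circle_vec_def dist_norm power2_norm_eq_inner inner_diff_left
      inner_diff_right inner_commute[of d c] field_simps)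

lemma inv_form_circle_vec_self: "r \<noteq> 0 \<Longrightarrow> inv_form (circle_vec c r) (circle_vec c r) = -1"
  by (simp add: inv_form_circle_vec power2_eq_square)

lemma inv_form_circle_vec_ge_1:
  assumes "0 < r" "0 < s"
  shows "1 \<le> inv_form (circle_vec c r) (circle_vec d s) \<longleftrightarrow> r + s \<le> dist c d"
proof -
  have "1 \<le> inv_form (circle_vec c r) (circle_vec d s) \<longleftrightarrow> (r + s)\<^sup>2 \<le> (dist c d)\<^sup>2"
    using assms by (simp add: inv_form_circle_vec field_simps power2_sum)
  also have "\<dots> \<longleftrightarrow> r + s \<le> dist c d"
    using assms by (simp add: abs_le_square_iff[symmetric])
  finally show ?thesis .
qed

lemma inv_form_circle_vec_eq_1:
  assumes "0 < r" "0 < s"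
  shows "inv_form (circle_vec c r) (circle_vec d s) = 1 \<longleftrightarrow> dist c d = r + s"
proof -
  have "inv_form (circle_vec c r) (circle_vec d s) = 1 \<longleftrightarrow> (dist c d)\<^sup>2 = (r + s)\<^sup>2"
    using assms by (auto simp add: inv_form_circle_vec field_simps power2_sum)
  also have "\<dots> \<longleftrightarrow> dist c d = r + s"
    using assms by (simp add: power2_eq_iff_nonneg)
  finally show ?thesis .
qed

text \<open>Norm -1 determines the third entry once the first is nonzero, so curvature k > 0 and
  middle entry m leave only the circle with centre m/k and radius 1/k. This turns orbit vectors back
  into disks.\<close>

lemma circle_vec_cases:
  assumes "inv_form v v = -1" "fst v > 0"
  obtains c r where "0 < r" "v = circle_vec c r"
proof -
  obtain k m h where v: "v = (k, m, h)" by (cases v) auto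
  have k: "k > 0" and n: "k * h = (norm m)\<^sup>2 - 1"
    using assms by (simp_all add: v inv_form_def power2_norm_eq_inner algebra_simps)
  have h: "h = ((norm m)\<^sup>2 - 1) / k"
    using k n by (simp add: field_simps)
  have "v = circle_vec (m /\<^sub>R k) (1 / k)"
    using k by (simp add: v circle_vec_def h field_simps power2_eq_square)
  with k that[of "1 / k"] show ?thesis by simp
qed

lemma circle_vec_inject: "0 < r \<Longrightarrow> circle_vec c r = circle_vec d s \<Longrightarrow> c = d \<and> r = s"
  by (auto simp: circle_vec_def)

section \<open>Descartes quadruples\<close>

text \<open>The index type \<open>4\<close> is arithmetic modulo 4, which lets the spiral exchange
  its members in cyclic order.\<close>

definition descartes_quad :: "(4 \<Rightarrow> real \<times> complex \<times> real) \<Rightarrow> bool" where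
  "descartes_quad Q \<longleftrightarrow> (\<forall>i j. inv_form (Q i) (Q j) = (if i = j then -1 else 1))"

text \<open>Using the full sum instead of the sum of the other three costs one more multiple of
  \<open>Q i\<close>, but products with the full sum are the same for all members.\<close>

definition swap :: "4 \<Rightarrow> (4 \<Rightarrow> real \<times> complex \<times> real) \<Rightarrow> (4 \<Rightarrow> real \<times> complex \<times> real)" where
  "swap i Q = Q(i := 2 *\<^sub>R sum Q UNIV - 3 *\<^sub>R Q i)"

lemma ex_max_4: "\<exists>i. \<forall>j. x j \<le> x i" for x :: "4 \<Rightarrow> real"
proof -
  have "Max (range x) \<in> range x" by (rule Max_in) auto
  then obtain i where "x i = Max (range x)" by (metis imageE)
  then show ?thesis by (metis Max_ge finite finite_imageI rangeI)
qed

lemma scaleR_numerals: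
  "2 *\<^sub>R x = x + x" "3 *\<^sub>R x = x + x + x" "4 *\<^sub>R x = x + x + x + x" for x :: "'a::real_vector"
  using scaleR_left_distrib[of 1 1 x] scaleR_left_distrib[of 2 1 x] scaleR_left_distrib[of 3 1 x] by simp_all

lemma swap_swap [simp]: "swap i (swap i Q) = Q"
proof -
  have "sum (swap i Q) UNIV = 3 *\<^sub>R sum Q UNIV - 4 *\<^sub>R Q i"
    using exhaust_4[of i] by (auto simp: sum_4 swap_def algebra_simps scaleR_numerals)
  moreover have "2 *\<^sub>R (3 *\<^sub>R sum Q UNIV - 4 *\<^sub>R Q i) - 3 *\<^sub>R (2 *\<^sub>R sum Q UNIV - 3 *\<^sub>R Q i) = Q i"
    by (simp add: scaleR_numerals scaleR_right_diff_distrib)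
  ultimately show ?thesis
    by (simp add: swap_def[of i "swap i Q"]) (simp add: swap_def fun_eq_iff)
qed

lemma descartes_quad_sum:
  assumes "descartes_quad Q"
  shows "inv_form (sum Q UNIV) (Q i) = 2"
proof -
  have "inv_form (sum Q UNIV) (Q i) = (\<Sum>j\<in>UNIV. if j = i then -1 else 1)"
    using assms by (simp add: descartes_quad_def inv_form_sum_left)
  then show ?thesis using exhaust_4[of i] by (auto simp: sum_4)
qed

text \<open>With s the sum of the members, s has product 2 with each member and 8 with itself. Hence
  2 s - 3 (Q i) has norm 4 * 8 - 12 * 2 - 9 = -1 and product 2 * 2 - 3 = 1 with the other
  members.\<close>

lemma descartes_quad_swap:
  assumes "descartes_quad Q"
  shows "descartes_quad (swap i Q)"
proof -
  have 1: "inv_form (sum Q UNIV) (Q j) = 2" "inv_form (Q j) (sum Q UNIV) = 2" for j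
    using descartes_quad_sum[OF assms] by (auto simp: inv_form_commute)
  have 2: "inv_form (sum Q UNIV) (sum Q UNIV) = 8"
    by (simp add: inv_form_sum_right 1)
  show ?thesis
    using assms by (auto simp: descartes_quad_def swap_def inv_form_simps 1 2)
qed

text \<open>The Gram matrix is J - 2 I with J the all-ones matrix of size 4; since J J = 4 J, its
  inverse is J/4 - I/2, which yields these coefficients.\<close>

lemma descartes_quad_expansion:
  assumes "descartes_quad Q"
  shows "v = (\<Sum>i\<in>UNIV. ((\<Sum>j\<in>UNIV. inv_form v (Q j)) / 4 - inv_form v (Q i) / 2) *\<^sub>R Q i)"
proof -
  define f :: "real \<times> complex \<times> real \<Rightarrow> real \<times> complex \<times> real" where
    "f = (\<lambda>v. fst v *\<^sub>R Q 1 + Re (fst (snd v)) *\<^sub>R Q 2 + Im (fst (snd v)) *\<^sub>R Q 3 + snd (snd v) *\<^sub>R Q 4)"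
  have Q: "inv_form (Q i) (Q j) = (if i = j then -1 else 1)" for i j
    using assms by (simp add: descartes_quad_def)
  \<comment> \<open>A combination that vanishes is orthogonal to all members, so the nonsingular
    Gram matrix makes \<open>f\<close> injective; between spaces of dimension 4 it is then
    onto.\<close>
  have "linear f"
    unfolding f_def by (rule linearI) (auto simp: algebra_simps)
  moreover have "inj f"
  proof (subst linear_injective_0[OF \<open>linear f\<close>], intro allI impI)
    fix v assume "f v = 0"
    then have "inv_form (f v) (Q i) = 0" for i
      by (simp add: inv_form_simps)
    from this[of 1] this[of 2] this[of 3] this[of 4]
    show "v = 0"
      by (cases v) (simp add: f_def inv_form_simps Q complex_eq_iff zero_prod_def)
  qed
  ultimately have "surj f"
    by (intro linear_injective_imp_surjective) simp_all
  then obtain u where v: "v = f u" by (metis surjD)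
  obtain a z d where u: "u = (a, z, d)" by (cases u) auto
  show ?thesis
    unfolding v f_def u
    by (simp add: sum_4 inv_form_simps Q flip: scaleR_add_left)
      (simp add: field_simps flip: scaleR_add_left)
qed

text \<open>The expansion of v is paired with v itself. For the null vector (0, 0, 2), whose
  products are the curvatures, this is Descartes' circle theorem.\<close>

lemma descartes_quad_norm:
  assumes "descartes_quad Q"
  shows "4 * inv_form v v = (\<Sum>i\<in>UNIV. inv_form v (Q i))\<^sup>2 - 2 * (\<Sum>i\<in>UNIV. (inv_form v (Q i))\<^sup>2)"
proof -
  have "inv_form v v = (\<Sum>i\<in>UNIV. ((\<Sum>j\<in>UNIV. inv_form v (Q j)) / 4 - inv_form v (Q i) / 2) * inv_form v (Q i))"
    by (subst (2) descartes_quad_expansion[OF assms, of v])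
      (simp only: inv_form_sum_right inv_form_simps real_scaleR_def)
  then show ?thesis
    by (simp add: sum_4 power2_eq_square field_simps)
qed

lemma tangent_to_three:
  assumes "descartes_quad Q" "inv_form v v = -1" "\<And>j. j \<noteq> i \<Longrightarrow> inv_form v (Q j) = 1"
  shows "v = Q i \<or> v = swap i Q i"
proof -
  define t where "t = inv_form v (Q i)"
  have x: "inv_form v (Q j) = (if j = i then t else 1)" for j
    using assms(3) by (auto simp: t_def)
  have s: "(\<Sum>j\<in>UNIV. inv_form v (Q j)) = t + 3" "(\<Sum>j\<in>UNIV. (inv_form v (Q j))\<^sup>2) = t\<^sup>2 + 3"
    using exhaust_4[of i] unfolding x by (auto simp: sum_4)
  \<comment> \<open>The root -1 is the product of \<open>Q i\<close> with itself, the root 7 its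
    product with the swapped vector.\<close>
  have "(t - 7) * (t + 1) = 0"
    using descartes_quad_norm[OF assms(1), of v] unfolding assms(2) s
    by (simp add: power2_eq_square algebra_simps)
  then consider "t = -1" | "t = 7" by auto
  then show ?thesis
  proof cases
    case 1
    then have "v = (\<Sum>j\<in>UNIV. (if j = i then 1 else 0) *\<^sub>R Q j)"
      by (subst descartes_quad_expansion[OF assms(1), of v], unfold s, unfold x)
        (auto intro!: sum.cong)
    also have "\<dots> = Q i" using exhaust_4[of i] by (auto simp: sum_4)
    finally show ?thesis ..
  next
    case 2
    then have "v = (\<Sum>j\<in>UNIV. (if j = i then -1 else 2) *\<^sub>R Q j)"
      by (subst descartes_quad_expansion[OF assms(1), of v], unfold s, unfold x)
        (auto intro!: sum.cong)
    also have "\<dots> = swap i Q i" using exhaust_4[of i]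
      by (auto simp: sum_4 swap_def algebra_simps scaleR_numerals)
    finally show ?thesis ..
  qed
qed

lemma inv_form_swap:
  "inv_form v (swap i Q j) =
    (if j = i then 2 * (\<Sum>k\<in>UNIV. inv_form v (Q k)) - 3 * inv_form v (Q i) else inv_form v (Q j))"
  by (simp add: swap_def inv_form_simps inv_form_sum_right)

section \<open>Orbits of Descartes quadruples\<close>

inductive orbit :: "(4 \<Rightarrow> real \<times> complex \<times> real) \<Rightarrow> (4 \<Rightarrow> real \<times> complex \<times> real) \<Rightarrow> bool"
  for Q where
  base: "orbit Q Q"
| step: "orbit Q R \<Longrightarrow> orbit Q (swap i R)"

lemma orbit_trans: "orbit R S \<Longrightarrow> orbit Q R \<Longrightarrow> orbit Q S"
  by (induction rule: orbit.induct) (auto intro: orbit.intros)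

lemma orbit_sym: "orbit Q R \<Longrightarrow> orbit R Q"
proof (induction rule: orbit.induct)
  case (step R i)
  have "orbit (swap i R) R" using orbit.step[OF orbit.base[of "swap i R"], of i] by simp
  with step.IH show ?case by (rule orbit_trans)
qed (rule orbit.base)

lemma descartes_quad_orbit: "orbit Q R \<Longrightarrow> descartes_quad Q \<Longrightarrow> descartes_quad R"
  by (induction rule: orbit.induct) (auto intro: descartes_quad_swap)

text \<open>The last argument records the latest swap, \<open>None\<close> for the empty word.
  Forbidding its repetition excludes cancelling pairs, as swaps are involutions.\<close>

inductive reduced ::
  "(4 \<Rightarrow> real \<times> complex \<times> real) \<Rightarrow> (4 \<Rightarrow> real \<times> complex \<times> real) \<Rightarrow> 4 option \<Rightarrow> bool"
  for Q where
  base: "reduced Q Q None"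
| step: "reduced Q R l \<Longrightarrow> l \<noteq> Some i \<Longrightarrow> reduced Q (swap i R) (Some i)"

lemma orbit_imp_reduced: "orbit Q R \<Longrightarrow> \<exists>l. reduced Q R l"
proof (induction rule: orbit.induct)
  case (step R i)
  obtain l where l: "reduced Q R l" using step.IH ..
  show ?case
  proof (cases "l = Some i")
    case True
    from l show ?thesis unfolding True by cases auto
  qed (use l in \<open>auto intro: reduced.intros\<close>)
qed (auto intro: reduced.intros)

text \<open>The first conjunct is the goal, the others make the induction work. The half-sum bound
  says that an allowed swap does not lower the product it replaces; nonnegative pair sums carry this
  bound over to the next quadruple.\<close>

lemma reduced_inv_form:
  assumes "reduced Q R l" "descartes_quad Q" "w = Q m"
  shows "(\<forall>i. 1 \<le> inv_form w (R i) \<or> R i = w) \<and>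
    (\<forall>i j. i \<noteq> j \<longrightarrow> 0 \<le> inv_form w (R i) + inv_form w (R j)) \<and>
    (\<forall>i. l \<noteq> Some i \<longrightarrow> 2 * inv_form w (R i) \<le> (\<Sum>j\<in>UNIV. inv_form w (R j)))"
  using assms(1)
proof induction
  case base
  have x: "inv_form w (Q i) = (if i = m then -1 else 1)" for i
    using assms(2,3) by (simp add: descartes_quad_def)
  show ?case using exhaust_4[of m] unfolding x
    by (auto simp: sum_4 assms(3))
next
  case (step R l i)
  have ww: "inv_form w w = -1"
    using assms(2,3) by (simp add: descartes_quad_def)
  define x where "x j = inv_form w (R j)" for j
  define y where "y j = inv_form w (swap i R j)" for j
  have y: "y j = (if j = i then 2 * (x 1 + x 2 + x 3 + x 4) - 3 * x i else x j)" for j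
    by (simp add: y_def x_def inv_form_swap sum_4)
  have p: "0 \<le> x j + x k" if "j \<noteq> k" for j k
    using step.IH that by (simp add: x_def)
  have d: "x j = -1 \<or> 1 \<le> x j" for j
    using step.IH ww by (metis x_def)
  have m: "2 * x i \<le> x 1 + x 2 + x 3 + x 4"
    using step.IH step.hyps by (simp add: x_def sum_4)
  have pp: "0 \<le> x 1 + x 2" "0 \<le> x 1 + x 3" "0 \<le> x 1 + x 4" "0 \<le> x 2 + x 3" "0 \<le> x 2 + x 4" "0 \<le> x 3 + x 4"
    by (auto intro!: p)
  \<comment> \<open>By \<open>m\<close> the new product is at least the sum of the other three. At
    most one of these is -1, since pair sums are nonnegative, and the rest are at least 1.\<close>
  have "1 \<le> y i"
    using exhaust_4[of i] m pp d[of 1] d[of 2] d[of 3] d[of 4] unfolding y by auto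
  then have 1: "\<forall>j. 1 \<le> y j \<or> swap i R j = w"
    using step.IH by (auto simp: y_def swap_def)
  have 2: "\<forall>j k. j \<noteq> k \<longrightarrow> 0 \<le> y j + y k"
    using exhaust_4[of i] m pp unfolding forall_4 y by auto
  have 3: "\<forall>j. Some i \<noteq> Some j \<longrightarrow> 2 * y j \<le> y 1 + y 2 + y 3 + y 4"
    using exhaust_4[of i] m pp unfolding forall_4 y by auto
  show ?case
    using 1 2 3 by (simp add: sum_4 y_def)
qed

text \<open>Orbits are symmetric, so S is reached from R by a reduced word, and the invariant
  applies with \<open>R i\<close> as the fixed vector.\<close>

lemma orbit_inv_form_ge_1:
  assumes "descartes_quad Q" "orbit Q R" "orbit Q S" "R i \<noteq> S j"
  shows "1 \<le> inv_form (R i) (S j)"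
proof -
  have "orbit R S" "descartes_quad R"
    using assms orbit_sym orbit_trans descartes_quad_orbit by blast+
  then show ?thesis
    using orbit_imp_reduced reduced_inv_form assms(4) by metis
qed

section \<open>Descent\<close>

text \<open>The measure is real, hence not well-founded by itself; the fixed drop of 1 takes the
  place of well-foundedness.\<close>

lemma archimedean_descent:
  fixes f :: "'a \<Rightarrow> real"
  assumes "P a" and "\<And>x. P x \<Longrightarrow> 0 \<le> f x"
    and "\<And>x. P x \<Longrightarrow> G x \<or> (\<exists>y. P y \<and> f y \<le> f x - 1)"
  shows "\<exists>x. P x \<and> G x"
proof (rule ccontr)
  assume no: "\<not> ?thesis"
  have "\<exists>x. P x \<and> f x \<le> f a - real n" for n
  proof (induction n)
    case (Suc n)
    then obtain x where "P x" "f x \<le> f a - real n" by blast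
    moreover obtain y where "P y" "f y \<le> f x - 1" using assms(3) no \<open>P x\<close> by blast
    ultimately show ?case by (intro exI[of _ y]) auto
  qed (use assms(1) in auto)
  moreover obtain n where "f a < real n" using reals_Archimedean2 by blast
  ultimately obtain x where "P x" "f x < 0" by (metis diff_less_0_iff_less order_le_less_trans)
  then show False using assms(2) by force
qed

lemma ex_4: "(\<exists>i::4. P i) \<longleftrightarrow> P 1 \<or> P 2 \<or> P 3 \<or> P 4"
  by (metis exhaust_4)

text \<open>As an equation in d it has the roots a + b + c plus or minus 2 sqrt (a b + a c + b c +
  \<nu>). Both cases for \<nu> make the radicand at least 4. The smaller root is excluded: with d at
  least a it would force 4 (a b + a c + b c + \<nu>) below (b + c) squared, impossible for b and c
  at most a.\<close>

lemma largest_root_bound_ordered: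
  fixes a b c d \<nu> :: real
  assumes "1 \<le> a" "1 \<le> b" "1 \<le> c" "b \<le> a" "c \<le> a" "a \<le> d"
    and eq: "2 * (a\<^sup>2 + b\<^sup>2 + c\<^sup>2 + d\<^sup>2) = (a + b + c + d)\<^sup>2 + 4 * \<nu>"
    and \<nu>: "1 \<le> \<nu> \<or> \<nu> = -3 \<and> 3 \<le> a"
  shows "a + b + c + 4 \<le> d"
proof -
  have sq: "(d - (a + b + c))\<^sup>2 = 4 * (a * b + a * c + b * c + \<nu>)"
    using eq by (simp add: power2_eq_square algebra_simps)
  have le: "a \<le> a * b" "a \<le> a * c" "1 \<le> b * c"
    using assms mult_left_mono[of 1 b a] mult_left_mono[of 1 c a] mult_mono[of 1 b 1 c] by auto
  have "a + b + c \<le> d"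
  proof (rule ccontr)
    assume "\<not> ?thesis"
    then have "((a + b + c) - d)\<^sup>2 \<le> (b + c)\<^sup>2"
      using assms by (intro power_mono) auto
    then have "4 * (a * b + a * c + b * c + \<nu>) \<le> (b + c)\<^sup>2"
      by (simp only: sq[symmetric] power2_commute[of "a + b + c"])
    then have "4 * (a * b) + 4 * (a * c) + 2 * (b * c) + 4 * \<nu> \<le> b * b + c * c"
      by (simp add: power2_eq_square algebra_simps)
    moreover have "b * b \<le> a * b" "c * c \<le> a * c"
      using assms by (auto intro!: mult_right_mono)
    ultimately show False
      using \<nu> le assms(1) by argo
  qed
  moreover have "16 \<le> (d - (a + b + c))\<^sup>2"
    unfolding sq using \<nu> le assms(1) by argo
  then have "4\<^sup>2 \<le> (d - (a + b + c))\<^sup>2"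
    by simp
  ultimately show ?thesis
    unfolding abs_le_square_iff[symmetric] by simp
qed

lemma largest_root_bound:
  fixes a b c d \<nu> :: real
  assumes ge: "1 \<le> a" "1 \<le> b" "1 \<le> c" and le: "a \<le> d" "b \<le> d" "c \<le> d"
    and eq: "2 * (a\<^sup>2 + b\<^sup>2 + c\<^sup>2 + d\<^sup>2) = (a + b + c + d)\<^sup>2 + 4 * \<nu>"
    and \<nu>: "1 \<le> \<nu> \<or> \<nu> = -3 \<and> (3 \<le> a \<or> 3 \<le> b \<or> 3 \<le> c)"
  shows "a + b + c + 4 \<le> d"
proof -
  consider "b \<le> a" "c \<le> a" | "a \<le> b" "c \<le> b" | "a \<le> c" "b \<le> c" by linarith
  then show ?thesis
  proof cases
    case 1
    then show ?thesis using assms by (intro largest_root_bound_ordered[of a b c d \<nu>]) auto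
  next
    case 2
    then have "b + a + c + 4 \<le> d"
      using assms by (intro largest_root_bound_ordered[of b a c d \<nu>]) (auto simp: ac_simps)
    then show ?thesis by simp
  next
    case 3
    then have "c + a + b + 4 \<le> d"
      using assms by (intro largest_root_bound_ordered[of c a b d \<nu>]) (auto simp: ac_simps)
    then show ?thesis by simp
  qed
qed

lemma dominant_coordinate:
  fixes x :: "4 \<Rightarrow> real"
  assumes ge: "\<And>i. 1 \<le> x i"
    and eq: "2 * (\<Sum>i\<in>UNIV. (x i)\<^sup>2) = (\<Sum>i\<in>UNIV. x i)\<^sup>2 + 4 * \<nu>"
    and \<nu>: "1 \<le> \<nu> \<or> \<nu> = -3 \<and> (\<forall>i. \<exists>j. j \<noteq> i \<and> 3 \<le> x j)"
  shows "\<exists>i. (\<Sum>j\<in>UNIV. x j) + 4 \<le> 2 * x i"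
proof -
  obtain i where i: "\<And>j. x j \<le> x i" using ex_max_4[of x] by blast
  have \<nu>i: "1 \<le> \<nu> \<or> \<nu> = -3 \<and> (\<exists>j. j \<noteq> i \<and> 3 \<le> x j)" using \<nu> by blast
  have eq4: "2 * ((x 1)\<^sup>2 + (x 2)\<^sup>2 + (x 3)\<^sup>2 + (x 4)\<^sup>2) = (x 1 + x 2 + x 3 + x 4)\<^sup>2 + 4 * \<nu>"
    using eq by (simp add: sum_4)
  note bound = largest_root_bound[where \<nu> = \<nu>, OF ge ge ge i i i]
  have "x 1 + x 2 + x 3 + x 4 + 4 \<le> 2 * x i"
    using exhaust_4[of i]
  proof (elim disjE)
    assume "i = 1"
    then show ?thesis
      using bound[of 2 3 4] eq4 \<nu>i by (auto simp: ac_simps ex_4)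
  next
    assume "i = 2"
    then show ?thesis
      using bound[of 1 3 4] eq4 \<nu>i by (auto simp: ac_simps ex_4)
  next
    assume "i = 3"
    then show ?thesis
      using bound[of 1 2 4] eq4 \<nu>i by (auto simp: ac_simps ex_4)
  next
    assume "i = 4"
    then show ?thesis
      using bound[of 1 2 3] eq4 \<nu>i by (auto simp: ac_simps ex_4)
  qed
  then show ?thesis by (auto simp: sum_4)
qed

text \<open>A swap at i turns the sum s of the products x into 3 s - 4 (x i). A coordinate with s +
  4 <= 2 (x i) thus lowers it by at least 8, more than the descent needs. Norm -1 serves a disk
  missing the packing, norm 3 the sum of three mutually tangent members.\<close>

lemma dominant_swap:
  assumes Q: "descartes_quad Q" and ge: "\<And>i. 1 \<le> inv_form v (Q i)"
    and v: "inv_form v v \<le> -1 \<or> inv_form v v = 3 \<and> (\<forall>i. \<exists>j. j \<noteq> i \<and> 3 \<le> inv_form v (Q j))"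
  shows "\<exists>i. (\<Sum>j\<in>UNIV. inv_form v (swap i Q j)) \<le> (\<Sum>j\<in>UNIV. inv_form v (Q j)) - 1"
proof -
  obtain i where i: "(\<Sum>j\<in>UNIV. inv_form v (Q j)) + 4 \<le> 2 * inv_form v (Q i)"
    using dominant_coordinate[of "\<lambda>i. inv_form v (Q i)" "- inv_form v v", OF ge]
      descartes_quad_norm[OF Q, of v] v by auto
  have "(\<Sum>j\<in>UNIV. inv_form v (swap i Q j)) =
      3 * (\<Sum>j\<in>UNIV. inv_form v (Q j)) - 4 * inv_form v (Q i)"
    using exhaust_4[of i] unfolding inv_form_swap by (auto simp: sum_4)
  with i show ?thesis by (intro exI[of _ i]) linarith
qed

section \<open>Tangency on the Riemann sphere\<close>

lemma Some_in_interior_riemann_sphere: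
  "Some z \<in> riemann_sphere interior_of D \<longleftrightarrow> z \<in> interior {w. Some w \<in> D}"
proof
  assume "Some z \<in> riemann_sphere interior_of D"
  then obtain T where T: "openin riemann_sphere T" "Some z \<in> T" "T \<subseteq> D"
    by (auto simp: interior_of_def)
  then obtain U where "open U" "{w. Some w \<in> T} = U"
    by (auto simp: riemann_sphere_def openin_Alexandroff_compactification Compl_eq_Diff_UNIV[symmetric])
  then show "z \<in> interior {w. Some w \<in> D}"
    using T by (intro interiorI[of U]) auto
next
  assume "z \<in> interior {w. Some w \<in> D}"
  then obtain U where "open U" "z \<in> U" "U \<subseteq> {w. Some w \<in> D}" by (auto elim: interiorE)
  then show "Some z \<in> riemann_sphere interior_of D"
    by (auto simp: interior_of_def riemann_sphere_def intro!: exI[of _ "Some ` U"])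
qed

text \<open>An ordinary disk omits infinity, so only finite points matter. \<open>D\<close> stays
  arbitrary in order to cover half-planes and exteriors as well.\<close>

lemma disjnt_interior_disk_iff:
  "disjnt (riemann_sphere interior_of D) (riemann_sphere interior_of (disk d s)) \<longleftrightarrow>
    interior {w. Some w \<in> D} \<inter> ball d s = {}"
proof -
  have "None \<notin> riemann_sphere interior_of (disk d s)"
    using interior_of_subset[of riemann_sphere "disk d s"] by (auto simp: disk_def)
  moreover have "{w. Some w \<in> disk d s} = cball d s"
    by (auto simp: disk_def)
  then have "interior {w. Some w \<in> disk d s} = ball d s"
    by (metis interior_cball)
  ultimately show ?thesis
    unfolding disjnt_iff split_option_all Some_in_interior_riemann_sphere by auto
qed

lemma ball_disjoint_iff:
  fixes c d :: "'a::real_normed_vector"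
  assumes "0 < r" "0 < s"
  shows "ball c r \<inter> ball d s = {} \<longleftrightarrow> r + s \<le> dist c d"
proof
  assume dis: "ball c r \<inter> ball d s = {}"
  show "r + s \<le> dist c d"
  proof (rule ccontr)
    assume *: "\<not> ?thesis"
    \<comment> \<open>The point dividing the segment of centres in the ratio r : s lies in both
      balls if the centres are too close.\<close>
    define p where "p = c + (r / (r + s)) *\<^sub>R (d - c)"
    have "d - p = (s / (r + s)) *\<^sub>R (d - c)"
      using assms by (simp add: p_def algebra_simps flip: scaleR_add_left)
        (simp add: field_simps flip: scaleR_add_left add_divide_distrib)
    then have "dist d p = s * (dist c d / (r + s))" "dist c p = r * (dist c d / (r + s))"
      using assms by (simp_all add: p_def dist_norm norm_minus_commute)
    moreover have "dist c d / (r + s) < 1" using * assms by simp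
    ultimately have "p \<in> ball c r \<inter> ball d s"
      using assms mult_strict_left_mono[of "dist c d / (r + s)" 1] by force
    with dis show False by blast
  qed
qed (rule disjoint_ballI)

lemma disjnt_interior_disk_disk:
  assumes "0 < r" "0 < s"
  shows "disjnt (riemann_sphere interior_of (disk c r)) (riemann_sphere interior_of (disk d s)) \<longleftrightarrow>
    r + s \<le> dist c d"
proof -
  have "{w. Some w \<in> disk c r} = cball c r"
    by (auto simp: disk_def)
  then show ?thesis
    using assms by (simp add: disjnt_interior_disk_iff ball_disjoint_iff)
qed

lemma tangent_disk_disk:
  assumes "0 < r" "0 < s"
  shows "tangent (disk c r) (disk d s) \<longleftrightarrow> dist c d = r + s"
proof
  assume t: "tangent (disk c r) (disk d s)"
  then obtain p where "dist c p \<le> r" "dist d p \<le> s"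
    by (auto simp: tangent_def disk_def)
  then have "dist c d \<le> r + s"
    using dist_triangle[of c d p] by (simp add: dist_commute)
  then show "dist c d = r + s"
    using t assms by (simp add: tangent_def disjnt_interior_disk_disk)
next
  assume dist: "dist c d = r + s"
  define p where "p = c + (r / (r + s)) *\<^sub>R (d - c)"
  have ex: "dist c p = r" "dist p d = s"
  proof -
    have "d - p = (s / (r + s)) *\<^sub>R (d - c)"
      using assms by (simp add: p_def algebra_simps flip: scaleR_add_left)
        (simp add: field_simps flip: scaleR_add_left add_divide_distrib)
    then show "dist c p = r" "dist p d = s"
      using assms dist by (simp_all add: p_def dist_norm norm_minus_commute)
  qed
  have "q = p" if "dist c q \<le> r" "dist d q \<le> s" for q
  proof -
    \<comment> \<open>A common point attains equality in the triangle inequality, so it lies on the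
      segment, at distance exactly r from c.\<close>
    have "between (c, d) q"
      using that dist dist_triangle[of c d q] by (simp add: between dist_commute)
    then obtain u where u: "0 \<le> u" "q = c + u *\<^sub>R (d - c)"
      by (auto simp: between_mem_segment closed_segment_def algebra_simps)
    have "dist c q = r"
      using that dist dist_triangle[of c d q] by (simp add: dist_commute)
    then have "u * (r + s) = r"
      using u dist by (simp add: dist_norm norm_minus_commute)
    then have "u = r / (r + s)" using assms by (simp add: field_simps)
    then show "q = p" by (simp add: u p_def)
  qed
  then have "\<exists>!p. p \<in> disk c r \<inter> disk d s"
    using ex by (intro ex1I[of _ "Some p"]) (auto simp: disk_def dist_commute)
  then show "tangent (disk c r) (disk d s)"
    using assms dist by (simp add: tangent_def disjnt_interior_disk_disk)
qed

lemma tangent_half_plane_disk: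
  assumes "a \<noteq> 0" "0 < s" "tangent (half_plane a b) (disk d s)"
  shows "a \<bullet> d - s * norm a = b"
proof (rule antisym)
  obtain p where p: "a \<bullet> p \<le> b" "dist d p \<le> s"
    using assms(3) by (auto simp: tangent_def half_plane_def disk_def)
  have "a \<bullet> (d - p) \<le> norm a * s"
    using p by (intro order_trans[OF norm_cauchy_schwarz]) (simp add: dist_norm mult_left_mono)
  then show "a \<bullet> d - s * norm a \<le> b"
    using p by (simp add: inner_diff_right algebra_simps)
next
  have "interior {w. Some w \<in> half_plane a b} \<inter> ball d s = {}"
    using assms(3) by (simp add: tangent_def disjnt_interior_disk_iff)
  moreover have "{w. Some w \<in> half_plane a b} = {w. a \<bullet> w \<le> b}"
    by (auto simp: half_plane_def)
  ultimately have "ball d s \<subseteq> {w. a \<bullet> w \<ge> b}"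
    using assms(1) by (auto simp: disjoint_iff not_less simp del: mem_ball)
  then have "closure (ball d s) \<subseteq> {w. a \<bullet> w \<ge> b}"
    by (rule closure_minimal) (rule closed_halfspace_ge)
  \<comment> \<open>The point of the closed disk that reaches furthest towards the
    half-plane.\<close>
  moreover have "d - (s / norm a) *\<^sub>R a \<in> closure (ball d s)"
    using assms by (simp add: dist_norm)
  ultimately have "b \<le> a \<bullet> (d - (s / norm a) *\<^sub>R a)" by auto
  also have "\<dots> = a \<bullet> d - s * norm a"
    using assms(1) by (simp add: inner_diff_right power2_norm_eq_inner[symmetric] power2_eq_square)
  finally show "b \<le> a \<bullet> d - s * norm a" .
qed

text \<open>The common point prevents the closed disk from lying in the open ball about c, while
  disjoint interiors put the open disk into the closed ball. Together the two inclusion criteria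
  leave equality.\<close>

lemma tangent_exterior_disk_disk:
  assumes "0 < r" "0 < s" "tangent (exterior_disk c r) (disk d s)"
  shows "dist c d = r - s"
proof -
  have D: "{w. Some w \<in> exterior_disk c r} = - ball c r"
    by (auto simp: exterior_disk_def)
  have "\<not> cball d s \<subseteq> ball c r"
    using assms(3) by (auto simp: tangent_def exterior_disk_def disk_def)
  moreover have "ball d s \<subseteq> cball c r"
    using assms by (auto simp: tangent_def disjnt_interior_disk_iff D interior_closure)
  ultimately show ?thesis
    using assms by (simp add: cball_subset_ball_iff ball_subset_cball_iff dist_commute)
qed

text \<open>Complements of circles and half-planes correspond to vectors with a non-positive first
  entry, which is the curvature.\<close>

lemma generalized_disk_vector:
  assumes "generalized_disk G"
  obtains (vector) v where "inv_form v v = -1"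
    "\<And>d s. 0 < s \<Longrightarrow> tangent G (disk d s) \<Longrightarrow> inv_form v (circle_vec d s) = 1"
    "fst v > 0 \<Longrightarrow> \<exists>c r. 0 < r \<and> G = disk c r \<and> v = circle_vec c r"
proof -
  consider (disk) c r where "0 < r" "G = disk c r"
    | (half_plane) a b where "a \<noteq> 0" "G = half_plane a b"
    | (ext) c r where "0 < r" "G = exterior_disk c r"
    using assms by (auto simp: generalized_disk_def ordinary_disk_def)
  then show thesis
  proof cases
    case disk
    then show ?thesis
      by (intro vector[of "circle_vec c r"])
        (auto simp: inv_form_circle_vec_self inv_form_circle_vec_eq_1 tangent_disk_disk)
  next
    case half_plane
    show ?thesis
    \<comment> \<open>The limit of the vectors of disks inside the half-plane that touch its
      boundary line at a fixed point, as their radius grows.\<close>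
    proof (rule vector[of "(0, - a /\<^sub>R norm a, - 2 * b / norm a)"])
      fix d s assume "0 < s" "tangent G (disk d s)"
      with half_plane have "a \<bullet> d - s * norm a = b"
        by (simp add: tangent_half_plane_disk)
      then show "inv_form (0, - a /\<^sub>R norm a, - 2 * b / norm a) (circle_vec d s) = 1"
        using half_plane \<open>0 < s\<close> by (auto simp: inv_form_def circle_vec_def field_simps)
    qed (use half_plane in \<open>auto simp: inv_form_def power2_norm_eq_inner[symmetric] power2_eq_square\<close>)
  next
    case ext
    show ?thesis
    proof (rule vector[of "circle_vec c (- r)"])
      fix d s assume "0 < s" "tangent G (disk d s)"
      with ext have "dist c d = r - s"
        by (simp add: tangent_exterior_disk_disk)
      then show "inv_form (circle_vec c (- r)) (circle_vec d s) = 1"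
        using ext \<open>0 < s\<close> by (simp add: inv_form_circle_vec divide_simps) (simp add: power2_eq_square algebra_simps)
    qed (use ext in \<open>auto simp: inv_form_circle_vec_self fst_circle_vec\<close>)
  qed
qed


section \<open>Disks of an orbit\<close>

text \<open>Three tangent members may come from three different quadruples; only when one quadruple
  holds all of them is a disk inscribed between them a swap.\<close>

lemma orbit_common_quad:
  assumes Q: "descartes_quad Q" and R: "orbit Q R1" "orbit Q R2" "orbit Q R3"
    and w: "w1 = R1 i1" "w2 = R2 i2" "w3 = R3 i3"
    and t: "inv_form w1 w2 = 1" "inv_form w1 w3 = 1" "inv_form w2 w3 = 1"
  shows "\<exists>S i. orbit Q S \<and> {w1, w2, w3} = S ` (- {i})"
proof -
  define u where "u = w1 + w2 + w3"
  have ww: "inv_form w1 w1 = -1" "inv_form w2 w2 = -1" "inv_form w3 w3 = -1"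
    using descartes_quad_orbit[OF _ Q] R w by (auto simp: descartes_quad_def)
  have uu: "inv_form u u = 3"
    using ww t inv_form_commute by (simp add: u_def inv_form_simps)
  \<comment> \<open>One of the three summands contributes -1 + 1 + 1 = 1; any other orbit vector has
    product at least 1 with each. So the product 1 detects the three members.\<close>
  have x: "inv_form u (S i) = 1 \<and> S i \<in> {w1, w2, w3} \<or> 3 \<le> inv_form u (S i)" if "orbit Q S" for S i
  proof -
    have ge: "w1 = S i \<or> 1 \<le> inv_form w1 (S i)" "w2 = S i \<or> 1 \<le> inv_form w2 (S i)"
      "w3 = S i \<or> 1 \<le> inv_form w3 (S i)"
      using orbit_inv_form_ge_1[OF Q] R that unfolding w by blast+
    show ?thesis
    proof (cases "S i \<in> {w1, w2, w3}")
      case True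
      then show ?thesis
        using ww t by (auto simp: u_def inv_form_simps inv_form_commute)
    qed (use ge in \<open>auto simp: u_def inv_form_simps\<close>)
  qed
  define f where "f S = (\<Sum>i\<in>UNIV. inv_form u (S i))" for S :: "4 \<Rightarrow> real \<times> complex \<times> real"
  have "\<exists>S. orbit Q S \<and> (\<exists>i. \<forall>j. j \<noteq> i \<longrightarrow> inv_form u (S j) = 1)"
  proof (rule archimedean_descent[where f = f])
    show "orbit Q Q" by (rule orbit.base)
  next
    fix S assume S: "orbit Q S"
    show "0 \<le> f S"
      unfolding f_def
    proof (rule sum_nonneg)
      fix i show "0 \<le> inv_form u (S i)" using x[OF S, of i] by linarith
    qed
  next
    fix S assume S: "orbit Q S"
    show "(\<exists>i. \<forall>j. j \<noteq> i \<longrightarrow> inv_form u (S j) = 1) \<or> (\<exists>T. orbit Q T \<and> f T \<le> f S - 1)"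
    proof (rule disjCI)
      assume "\<not> (\<exists>T. orbit Q T \<and> f T \<le> f S - 1)"
      then have no: "\<not> (\<exists>i. f (swap i S) \<le> f S - 1)"
        using orbit.step[OF S] by blast
      have ge: "1 \<le> inv_form u (S i)" for i using x[OF S, of i] by linarith
      \<comment> \<open>No swap lowers \<open>f\<close>, so the condition for norm 3 fails: at some
        i all other products are below 3, hence equal to 1.\<close>
      have "\<not> (\<forall>i. \<exists>j. j \<noteq> i \<and> 3 \<le> inv_form u (S j))"
        using dominant_swap[OF descartes_quad_orbit[OF S Q], of u, OF ge] no uu unfolding f_def by blast
      then show "\<exists>i. \<forall>j. j \<noteq> i \<longrightarrow> inv_form u (S j) = 1"
        using x[OF S] by blast
    qed
  qed
  then obtain S i where S: "orbit Q S" and i: "\<And>j. j \<noteq> i \<Longrightarrow> inv_form u (S j) = 1" by blast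
  have "S ` (- {i}) \<subseteq> {w1, w2, w3}"
    using x[OF S] i by force
  moreover have "inj_on S (- {i})"
  proof (rule inj_onI)
    fix j k assume "S j = S k"
    moreover have "inv_form (S j) (S j) = -1" "inv_form (S j) (S k) = (if j = k then -1 else 1)"
      using descartes_quad_orbit[OF S Q] by (simp_all add: descartes_quad_def)
    ultimately show "j = k" by (auto split: if_splits)
  qed
  then have "card (S ` (- {i})) = 3"
    by (simp add: card_image Compl_eq_Diff_UNIV card_Diff_singleton)
  moreover have "card {w1, w2, w3} \<le> 3"
    by (simp add: card_insert_if)
  ultimately have "S ` (- {i}) = {w1, w2, w3}"
    by (intro card_seteq) auto
  then show ?thesis using S by metis
qed


lemma orbit_dense:
  assumes Q: "descartes_quad Q" and pos: "\<forall>R i. orbit Q R \<longrightarrow> 0 < fst (R i)"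
    and "0 < e"
  shows "\<exists>R i c r. orbit Q R \<and> 0 < r \<and> R i = circle_vec c r \<and> ball z e \<inter> ball c r \<noteq> {}"
proof (rule ccontr)
  assume no: "\<not> ?thesis"
  define b where "b = circle_vec z e"
  have b: "inv_form b b = -1"
    using \<open>0 < e\<close> by (simp add: b_def inv_form_circle_vec_self)
  have ge: "1 \<le> inv_form b (R i)" if R: "orbit Q R" for R i
  proof -
    have "inv_form (R i) (R i) = -1"
      using descartes_quad_orbit[OF R Q] by (simp add: descartes_quad_def)
    moreover have "0 < fst (R i)" using pos R by blast
    ultimately obtain c r where r: "0 < r" "R i = circle_vec c r"
      by (rule circle_vec_cases)
    then have "ball z e \<inter> ball c r = {}" using no R by blast
    then show ?thesis
      using \<open>0 < e\<close> r by (simp add: b_def inv_form_circle_vec_ge_1 ball_disjoint_iff)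
  qed
  \<comment> \<open>With \<open>False\<close> as stopping condition, the descent would never
    end.\<close>
  have "\<exists>R. orbit Q R \<and> False"
  proof (rule archimedean_descent[where f = "\<lambda>R. \<Sum>i\<in>UNIV. inv_form b (R i)"])
    show "orbit Q Q" by (rule orbit.base)
  next
    fix R assume R: "orbit Q R"
    show "0 \<le> (\<Sum>i\<in>UNIV. inv_form b (R i))"
      using order_trans[OF zero_le_one ge[OF R]] by (rule sum_nonneg)
    show "False \<or> (\<exists>S. orbit Q S \<and> (\<Sum>i\<in>UNIV. inv_form b (S i)) \<le> (\<Sum>i\<in>UNIV. inv_form b (R i)) - 1)"
      using dominant_swap[OF descartes_quad_orbit[OF R Q], of b] ge[OF R] b orbit.step[OF R] by auto
  qed
  then show False by blast
qed

definition orbit_disks :: "(4 \<Rightarrow> real \<times> complex \<times> real) \<Rightarrow> complex option set set" where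
  "orbit_disks Q = {disk c r | c r. 0 < r \<and> (\<exists>R i. orbit Q R \<and> R i = circle_vec c r)}"

lemma orbit_disksI: "orbit Q R \<Longrightarrow> 0 < r \<Longrightarrow> R i = circle_vec c r \<Longrightarrow> disk c r \<in> orbit_disks Q"
  by (auto simp: orbit_disks_def)

lemma fills_plane_orbit_disks:
  assumes Q: "descartes_quad Q" and pos: "\<forall>R i. orbit Q R \<longrightarrow> 0 < fst (R i)"
  shows "fills_plane_with_positive_curvature (orbit_disks Q)"
  unfolding fills_plane_with_positive_curvature_def
proof (intro conjI)
  show "\<forall>D\<in>orbit_disks Q. \<exists>k>0. has_curvature D k"
    unfolding positive_curvature_iff_ordinary_disk by (auto simp: orbit_disks_def ordinary_disk_def)
  show "pairwise (\<lambda>D E. disjnt (riemann_sphere interior_of D) (riemann_sphere interior_of E)) (orbit_disks Q)"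
  proof (rule pairwiseI)
    fix D E assume DE: "D \<in> orbit_disks Q" "E \<in> orbit_disks Q" "D \<noteq> E"
    obtain c r R i where D: "D = disk c r" "0 < r" "orbit Q R" "R i = circle_vec c r"
      using DE by (auto simp: orbit_disks_def)
    obtain d s S j where E: "E = disk d s" "0 < s" "orbit Q S" "S j = circle_vec d s"
      using DE by (auto simp: orbit_disks_def)
    have "R i \<noteq> S j" using D E DE circle_vec_inject by metis
    then have "1 \<le> inv_form (circle_vec c r) (circle_vec d s)"
      using orbit_inv_form_ge_1[OF Q D(3) E(3), of i j] D(4) E(4) by simp
    then show "disjnt (riemann_sphere interior_of D) (riemann_sphere interior_of E)"
      using D E by (simp add: inv_form_circle_vec_ge_1 disjnt_interior_disk_disk)
  qed
  show "closure {z. Some z \<in> \<Union> (orbit_disks Q)} = UNIV"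
  proof -
    have "z \<in> closure {z. Some z \<in> \<Union> (orbit_disks Q)}" for z
    proof (subst closure_approachable, intro allI impI)
      fix e :: real assume "0 < e"
      from orbit_dense[OF Q pos this] obtain R i c r
        where R: "orbit Q R" "0 < r" "R i = circle_vec c r" "ball z e \<inter> ball c r \<noteq> {}" by metis
      then obtain y where "dist z y < e" "dist c y < r" by auto
      then show "\<exists>y\<in>{z. Some z \<in> \<Union> (orbit_disks Q)}. dist y z < e"
        using orbit_disksI[OF R(1-3)] by (intro bexI[of _ y] CollectI UnionI[of "disk c r"])
          (auto simp: disk_def dist_commute)
    qed
    then show ?thesis by blast
  qed
qed

text \<open>A priori \<open>G\<close> may be a half-plane or an exterior. Its vector turns out to be
  a member of an orbit quadruple, and positive curvature there makes \<open>G\<close> an ordinary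
  disk.\<close>

lemma orbit_disks_inscribe:
  assumes Q: "descartes_quad Q" and pos: "\<forall>R i. orbit Q R \<longrightarrow> 0 < fst (R i)"
    and D: "D \<in> orbit_disks Q" "E \<in> orbit_disks Q" "F \<in> orbit_disks Q"
    and t: "mutually_tangent D E F"
    and G: "generalized_disk G" "tangent G D" "tangent G E" "tangent G F"
  shows "G \<in> orbit_disks Q"
proof -
  obtain c1 r1 R1 i1 where 1: "D = disk c1 r1" "0 < r1" "orbit Q R1" "R1 i1 = circle_vec c1 r1"
    using D by (auto simp: orbit_disks_def)
  obtain c2 r2 R2 i2 where 2: "E = disk c2 r2" "0 < r2" "orbit Q R2" "R2 i2 = circle_vec c2 r2"
    using D by (auto simp: orbit_disks_def)
  obtain c3 r3 R3 i3 where 3: "F = disk c3 r3" "0 < r3" "orbit Q R3" "R3 i3 = circle_vec c3 r3"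
    using D by (auto simp: orbit_disks_def)
  obtain S i where S: "orbit Q S" "{circle_vec c1 r1, circle_vec c2 r2, circle_vec c3 r3} = S ` (- {i})"
  proof -
    have "inv_form (circle_vec c1 r1) (circle_vec c2 r2) = 1"
      "inv_form (circle_vec c1 r1) (circle_vec c3 r3) = 1"
      "inv_form (circle_vec c2 r2) (circle_vec c3 r3) = 1"
      using t 1(1,2) 2(1,2) 3(1,2)
      by (simp_all add: mutually_tangent_def tangent_disk_disk inv_form_circle_vec_eq_1)
    from orbit_common_quad[OF Q 1(3) 2(3) 3(3) 1(4)[symmetric] 2(4)[symmetric] 3(4)[symmetric] this] that
    show ?thesis by blast
  qed
  obtain v where v: "inv_form v v = -1"
    "\<And>d s. 0 < s \<Longrightarrow> tangent G (disk d s) \<Longrightarrow> inv_form v (circle_vec d s) = 1"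
    "fst v > 0 \<Longrightarrow> \<exists>c r. 0 < r \<and> G = disk c r \<and> v = circle_vec c r"
    using generalized_disk_vector[OF G(1)] by metis
  have "inv_form v (circle_vec c1 r1) = 1" "inv_form v (circle_vec c2 r2) = 1"
    "inv_form v (circle_vec c3 r3) = 1"
    using G(2-4) 1(1,2) 2(1,2) 3(1,2) by (blast intro: v(2))+
  then have "\<forall>x \<in> S ` (- {i}). inv_form v x = 1"
    unfolding S(2)[symmetric] by simp
  then have "v = S i \<or> v = swap i S i"
    by (intro tangent_to_three[OF descartes_quad_orbit[OF S(1) Q] v(1)]) blast
  then obtain T where T: "orbit Q T" "T i = v"
    using S(1) orbit.step by metis
  then have "fst v > 0" using pos by metis
  with v(3) obtain c r where "0 < r" "G = disk c r" "v = circle_vec c r" by blast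
  then show ?thesis
    using orbit_disksI[OF T(1)] T(2) by simp
qed

lemma packing_of_seed_eq_orbit_disks:
  assumes Q: "descartes_quad Q" and pos: "\<forall>R i. orbit Q R \<longrightarrow> 0 < fst (R i)"
    and q: "Q 1 = circle_vec c1 r1" "Q 2 = circle_vec c2 r2" "Q 3 = circle_vec c3 r3"
    and r: "0 < r1" "0 < r2" "0 < r3"
  shows "packing_of_seed (disk c1 r1) (disk c2 r2) (disk c3 r3) = orbit_disks Q" (is "?P = _")
proof
  have seeds: "disk c1 r1 \<in> orbit_disks Q" "disk c2 r2 \<in> orbit_disks Q" "disk c3 r3 \<in> orbit_disks Q"
    using q r orbit_disksI[OF orbit.base] by metis+
  show "?P \<subseteq> orbit_disks Q"
  proof
    fix G assume "G \<in> ?P"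
    then show "G \<in> orbit_disks Q"
    proof induction
      case (inscribe D E F G)
      show ?case
        by (rule orbit_disks_inscribe[OF Q pos inscribe.IH inscribe.hyps(4-8)])
    qed (rule seeds)+
  qed
  \<comment> \<open>Each member of an orbit quadruple is inscribed between the other three. This
    serves \<open>Q 4\<close>, which is not among the seeds, and every swapped member.\<close>
  have inscribe: "disk c r \<in> ?P"
    if R: "orbit Q R" "0 < r" "R i = circle_vec c r"
      and mem: "\<And>j d s. j \<noteq> i \<Longrightarrow> 0 < s \<Longrightarrow> R j = circle_vec d s \<Longrightarrow> disk d s \<in> ?P" for R i c r
  proof -
    have gram: "inv_form (R i) (R j) = (if i = j then -1 else 1)" for i j
      using descartes_quad_orbit[OF R(1) Q] by (simp add: descartes_quad_def)
    have "0 < fst (R j)" for j using pos R(1) by blast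
    then have "\<exists>d s. 0 < s \<and> R j = circle_vec d s" for j
      using circle_vec_cases[of "R j"] gram[of j j] by metis
    then obtain d s where ds: "\<And>j. 0 < s j" "\<And>j. R j = circle_vec (d j) (s j)" by metis
    have tan: "tangent (disk (d j) (s j)) (disk (d k) (s k))" if "j \<noteq> k" for j k
      using gram[of j k] that ds by (simp add: tangent_disk_disk inv_form_circle_vec_eq_1)
    have c: "c = d i" "r = s i"
      using circle_vec_inject[OF R(2)] R(3) ds by metis+
    have mem': "disk (d j) (s j) \<in> ?P" if "j \<noteq> i" for j
      using mem that ds by metis
    have "disk (d i) (s i) \<in> ?P"
    proof (rule packing_of_seed.inscribe[OF mem'[of "i + 1"] mem'[of "i + 2"] mem'[of "i + 3"]])
      show "mutually_tangent (disk (d (i + 1)) (s (i + 1))) (disk (d (i + 2)) (s (i + 2)))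
          (disk (d (i + 3)) (s (i + 3)))"
        unfolding mutually_tangent_def by (intro conjI tan) simp_all
      show "generalized_disk (disk (d i) (s i))"
        using ds(1)[of i] unfolding generalized_disk_def ordinary_disk_def by blast
    qed ((rule tan)?, simp)+
    then show ?thesis
      unfolding c .
  qed
  have "\<forall>j d s. 0 < s \<longrightarrow> R j = circle_vec d s \<longrightarrow> disk d s \<in> ?P" if "orbit Q R" for R
    using that
  proof induction
    case base
    show ?case
    proof (intro allI impI)
      fix j d s assume s: "0 < s" "Q j = circle_vec d s"
      have 123: "disk d s \<in> ?P" if j: "j \<noteq> 4" "Q j = circle_vec d s" for j d s
      proof -
        consider "j = 1" | "j = 2" | "j = 3" using exhaust_4[of j] j(1) by blast
        then show ?thesis
          using j(2) q circle_vec_inject[OF r(1), of c1 d s] circle_vec_inject[OF r(2), of c2 d s]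
            circle_vec_inject[OF r(3), of c3 d s]
          by cases (simp_all add: packing_of_seed.intros(1-3))
      qed
      show "disk d s \<in> ?P"
      proof (cases "j = 4")
        case True
        show ?thesis
          by (rule inscribe[OF orbit.base s(1), of 4]) (use s 123 True in auto)
      qed (use 123 s in blast)
    qed
  next
    case (step R i)
    show ?case
    proof (intro allI impI)
      fix j d s assume s: "0 < s" "swap i R j = circle_vec d s"
      show "disk d s \<in> ?P"
      proof (cases "j = i")
        case True
        show ?thesis
        proof (rule inscribe[OF orbit.step[OF step.hyps] s(1)])
          show "swap i R i = circle_vec d s" using s(2) True by simp
        next
          fix k e t assume "k \<noteq> i" "0 < t" "swap i R k = circle_vec e t"
          then show "disk e t \<in> ?P" using step.IH by (simp add: swap_def)
        qed
      next
        case False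
        then show ?thesis using s step.IH by (simp add: swap_def)
      qed
    qed
  qed
  then show "orbit_disks Q \<subseteq> ?P"
    by (auto simp: orbit_disks_def)
qed

section \<open>The spiral\<close>

lemma phi_pos: "0 < phi" and tau_pos: "0 < tau"
  unfolding phi_def tau_def by (auto simp: add_pos_pos)

lemma phi_squared: "phi * phi = phi + 1"
  by (simp add: phi_def field_simps)

lemma tau_eq: "tau = phi - 1"
  by (simp add: tau_def phi_def field_simps)

lemma phi_tau: "phi * tau = 1" and tau_squared: "tau * tau = 1 - tau"
  using phi_squared by (simp_all add: tau_eq algebra_simps)

lemma sqrt_phi_sqrt_tau: "sqrt phi * sqrt tau = 1"
  by (metis phi_tau real_sqrt_mult real_sqrt_one)

lemma phi_sqrt_tau: "phi * sqrt tau = sqrt phi"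
proof -
  have "phi * sqrt tau = sqrt phi * (sqrt phi * sqrt tau)"
    using phi_pos by simp
  then show ?thesis by (simp add: sqrt_phi_sqrt_tau)
qed

lemma tau_sqrt_phi: "tau * sqrt phi = sqrt tau"
proof -
  have "tau * sqrt phi = (sqrt phi * sqrt tau) * sqrt tau"
    using tau_pos by simp
  then show ?thesis by (simp add: sqrt_phi_sqrt_tau)
qed

lemma rho_gt_1: "1 < rho"
proof -
  have "1 < phi" using tau_pos by (simp add: tau_eq)
  moreover have "0 < sqrt phi" using phi_pos by simp
  ultimately show ?thesis unfolding rho_def by linarith
qed

text \<open>Because phi^2 - 1 = phi, \<open>rho\<close> is phi + sqrt (phi^2 - 1), the larger root
  of x^2 - 2 phi x + 1.\<close>

lemma rho_squared: "rho * rho = 2 * phi * rho - 1"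
proof -
  have "sqrt phi * sqrt phi = phi" using phi_pos by simp
  then have "rho * rho = phi * phi + 2 * phi * sqrt phi + phi"
    by (simp add: rho_def algebra_simps)
  moreover have "2 * phi * rho = 2 * (phi * phi) + 2 * phi * sqrt phi"
    by (simp add: rho_def algebra_simps)
  ultimately show ?thesis using phi_squared by simp
qed

lemma rho_omega_eq: "of_real rho * omega = (1 + of_real (sqrt tau)) * (- 1 + of_real (sqrt phi) * \<i>)"
  using phi_tau phi_sqrt_tau tau_sqrt_phi sqrt_phi_sqrt_tau
  by (simp add: complex_eq_iff omega_def rho_def algebra_simps)

abbreviation (input) multiplier :: complex where
  "multiplier \<equiv> of_real rho * omega"

lemma Re_multiplier: "Re multiplier = - rho * tau"
  and Im_multiplier: "Im multiplier = rho * sqrt tau"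
  by (simp_all add: omega_def)

text \<open>\<open>omega\<close> has modulus 1, since tau^2 + tau = 1.\<close>

lemma multiplier_coords:
  "(Re multiplier)\<^sup>2 + (Im multiplier)\<^sup>2 = rho\<^sup>2"
proof -
  have "(Re multiplier)\<^sup>2 + (Im multiplier)\<^sup>2 = rho\<^sup>2 * (tau * tau + tau)"
    using tau_pos unfolding Re_multiplier Im_multiplier
    by (simp add: power_mult_distrib power2_eq_square[of tau] algebra_simps)
  then show ?thesis by (simp add: tau_squared)
qed

lemma norm_multiplier: "norm multiplier = rho"
  unfolding cmod_def multiplier_coords using rho_gt_1 by simp

lemma multiplier_neq: "multiplier \<noteq> 0" "multiplier \<noteq> 1"
  using norm_multiplier rho_gt_1 by auto

text \<open>Tangency of disks n and n + 2, divided by rho^n. After squaring, the left factors are 2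
  rho phi^2 and 2 rho, the right side is (2 phi rho)^2.\<close>

lemma norm_multiplier_1: "(1 + rho) * norm (1 + multiplier) = 1 + rho\<^sup>2"
proof -
  have "(norm (1 + multiplier))\<^sup>2 = 1 + 2 * Re multiplier + rho\<^sup>2"
    unfolding cmod_power2 multiplier_coords[symmetric] by (simp add: power2_eq_square algebra_simps)
  also have "\<dots> = 2 * rho * (phi - tau)"
    unfolding Re_multiplier power2_eq_square rho_squared by (simp add: algebra_simps)
  finally have n: "(norm (1 + multiplier))\<^sup>2 = 2 * rho" by (simp add: tau_eq)
  have "(1 + rho)\<^sup>2 = 2 * rho * (phi + 1)" "1 + rho\<^sup>2 = 2 * phi * rho"
    by (simp_all add: power2_eq_square algebra_simps rho_squared)
  then have "((1 + rho) * norm (1 + multiplier))\<^sup>2 = (1 + rho\<^sup>2)\<^sup>2"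
    unfolding power_mult_distrib n phi_squared[symmetric] by (simp add: power2_eq_square)
  then show ?thesis
    using rho_gt_1 by (subst (asm) power2_eq_iff_nonneg) auto
qed

text \<open>Tangency of disks n and n + 3, divided by rho^n. Both sides equal (1 + rho) * sqrt 5 *
  rho, by 2 phi - 1 = sqrt 5.\<close>

lemma norm_multiplier_2: "(1 + rho) * norm (1 + multiplier + multiplier\<^sup>2) = 1 + rho ^ 3"
proof -
  define x where "x = Re multiplier"
  have n2: "x\<^sup>2 + (Im multiplier)\<^sup>2 = rho\<^sup>2" unfolding x_def by (rule multiplier_coords)
  have "(norm (1 + multiplier + multiplier\<^sup>2))\<^sup>2 =
      (1 + x + x\<^sup>2 - (Im multiplier)\<^sup>2)\<^sup>2 + (1 + 2 * x)\<^sup>2 * (Im multiplier)\<^sup>2"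
    unfolding cmod_power2 x_def by (simp add: power2_eq_square algebra_simps)
  \<comment> \<open>Eliminating the imaginary part leaves a polynomial in x and \<open>rho\<close>,
    to be reduced by the quadratic relations.\<close>
  also have "(Im multiplier)\<^sup>2 = rho\<^sup>2 - x\<^sup>2" using n2 by simp
  also have "(1 + x + x\<^sup>2 - (rho\<^sup>2 - x\<^sup>2))\<^sup>2 + (1 + 2 * x)\<^sup>2 * (rho\<^sup>2 - x\<^sup>2) =
      (1 + rho\<^sup>2)\<^sup>2 - 3 * rho\<^sup>2 + 2 * x * (1 + rho\<^sup>2) + 4 * x\<^sup>2"
    by (simp add: power2_eq_square algebra_simps)
  also have "1 + rho\<^sup>2 = 2 * phi * rho"
    by (simp add: power2_eq_square rho_squared)
  also have "(2 * phi * rho)\<^sup>2 - 3 * rho\<^sup>2 + 2 * x * (2 * phi * rho) + 4 * x\<^sup>2 =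
      rho\<^sup>2 * (4 * (phi * phi) - 3 - 4 * (phi * tau) + 4 * (tau * tau))"
    unfolding x_def Re_multiplier by (simp add: power2_eq_square algebra_simps)
  also have "\<dots> = 5 * rho\<^sup>2"
    unfolding phi_squared phi_tau tau_squared by (simp add: tau_eq)
  finally have n: "(norm (1 + multiplier + multiplier\<^sup>2))\<^sup>2 = 5 * rho\<^sup>2" .
  have "1 + rho ^ 3 = (1 + rho) * (rho * rho - rho + 1)"
    by (simp add: power3_eq_cube algebra_simps)
  also have "rho * rho - rho + 1 = (2 * phi - 1) * rho"
    unfolding rho_squared by (simp add: algebra_simps)
  also have "2 * phi - 1 = sqrt 5"
  proof -
    have "2 * ((1 + x) / 2) - 1 = x" for x :: real by (simp add: field_simps)
    then show ?thesis unfolding phi_def .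
  qed
  finally have r: "1 + rho ^ 3 = (1 + rho) * (sqrt 5 * rho)" .
  have "(norm (1 + multiplier + multiplier\<^sup>2))\<^sup>2 = (sqrt 5 * rho)\<^sup>2"
    unfolding n by (simp add: power_mult_distrib)
  then have "norm (1 + multiplier + multiplier\<^sup>2) = sqrt 5 * rho"
    by (rule power2_eq_imp_eq) (use rho_gt_1 in auto)
  then show ?thesis by (simp add: r)
qed

text \<open>Self-similarity: the difference of centres is the n-th power of the multiplier times a
  geometric sum that does not depend on n, so tangency needs checking for j = 1, 2, 3 only.\<close>

lemma dist_spiral_center:
  "dist (spiral_center n) (spiral_center (n + int j)) =
    (1 + rho) * rho powi n * norm (\<Sum>k<j. multiplier ^ k)"
proof -
  have "spiral_center (n + int j) - spiral_center n =
      (1 + of_real rho) * ((multiplier powi (n + int j) - multiplier powi n) / (multiplier - 1))"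
    by (simp add: spiral_center_def right_diff_distrib diff_divide_distrib del: mult_eq_0_iff)
  also have "multiplier powi (n + int j) - multiplier powi n = multiplier powi n * (multiplier ^ j - 1)"
    by (simp only: power_int_add[OF disjI1[OF multiplier_neq(1)]] power_int_of_nat right_diff_distrib mult_1_right)
  also have "(1 + of_real rho) * (multiplier powi n * (multiplier ^ j - 1) / (multiplier - 1)) =
      (1 + of_real rho) * multiplier powi n * ((multiplier ^ j - 1) / (multiplier - 1))"
    by (simp only: times_divide_eq_right mult.assoc)
  also have "(multiplier ^ j - 1) / (multiplier - 1) = (\<Sum>k<j. multiplier ^ k)"
    by (rule geometric_sum[OF multiplier_neq(2), symmetric])
  finally have "dist (spiral_center n) (spiral_center (n + int j)) =
      norm ((1 + of_real rho) * multiplier powi n * (\<Sum>k<j. multiplier ^ k))"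
    by (metis dist_commute dist_norm)
  moreover have "norm (1 + of_real rho :: complex) = 1 + rho"
    using rho_gt_1 norm_of_real[of "1 + rho", where 'a = complex] by simp
  moreover have "norm (multiplier powi n) = rho powi n"
    by (simp only: norm_power_int norm_multiplier)
  ultimately show ?thesis
    by (simp only: norm_mult)
qed

lemma spiral_radius_pos: "0 < spiral_radius n"
  using rho_gt_1 by (simp add: spiral_radius_def)

lemma dist_spiral_center_near:
  assumes "m \<noteq> n" "\<bar>m - n\<bar> \<le> 3"
  shows "dist (spiral_center m) (spiral_center n) = spiral_radius m + spiral_radius n"
proof -
  have *: "dist (spiral_center n) (spiral_center (n + int j)) = spiral_radius n + spiral_radius (n + int j)"
    if "0 < j" "j \<le> 3" for n j
  proof -
    have "(1 + rho) * norm (\<Sum>k<j. multiplier ^ k) = 1 + rho ^ j"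
    proof -
      have "j = 1 \<or> j = 2 \<or> j = 3" using that by linarith
      then show ?thesis
        using norm_multiplier_1 norm_multiplier_2
        by (elim disjE) (simp_all add: eval_nat_numeral add.assoc)
    qed
    then have "(1 + rho) * rho powi n * norm (\<Sum>k<j. multiplier ^ k) = rho powi n * (1 + rho ^ j)"
      by (simp only: mult.commute[of "1 + rho" "rho powi n"] mult.assoc)
    then show ?thesis
      using rho_gt_1 by (simp only: dist_spiral_center) (simp add: spiral_radius_def power_int_add algebra_simps)
  qed
  show ?thesis
  proof (cases "m < n")
    case True
    then show ?thesis using *[of "nat (n - m)" m] assms by simp
  next
    case False
    then show ?thesis using *[of "nat (m - n)" n] assms by (simp add: dist_commute)
  qed
qed

lemma tangent_spiral_disk:
  "m \<noteq> n \<Longrightarrow> \<bar>m - n\<bar> \<le> 3 \<Longrightarrow> tangent (spiral_disk m) (spiral_disk n)"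
  by (simp add: spiral_disk_def tangent_disk_disk spiral_radius_pos dist_spiral_center_near)

lemma generalized_spiral_disk: "generalized_disk (spiral_disk n)"
  unfolding generalized_disk_def ordinary_disk_def spiral_disk_def
  using spiral_radius_pos by blast

section \<open>Spiral quadruples in a single orbit\<close>

definition spiral_vec :: "int \<Rightarrow> real \<times> complex \<times> real" where
  "spiral_vec n = circle_vec (spiral_center n) (spiral_radius n)"

lemma inv_form_spiral_vec:
  "\<bar>m - n\<bar> \<le> 3 \<Longrightarrow> inv_form (spiral_vec m) (spiral_vec n) = (if m = n then -1 else 1)"
  using spiral_radius_pos[of m] spiral_radius_pos[of n] dist_spiral_center_near[of m n]
  by (auto simp: spiral_vec_def inv_form_circle_vec_self inv_form_circle_vec_eq_1)

lemma fst_spiral_vec: "fst (spiral_vec n) = 1 / spiral_radius n"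
  by (simp add: spiral_vec_def fst_circle_vec)

lemma fst_spiral_vec_pos: "0 < fst (spiral_vec n)"
  using spiral_radius_pos by (simp add: fst_spiral_vec)

lemma fst_spiral_vec_less: "m < n \<Longrightarrow> fst (spiral_vec n) < fst (spiral_vec m)"
  using rho_gt_1 spiral_radius_pos[of m] spiral_radius_pos[of n]
  by (simp add: fst_spiral_vec field_simps) (simp add: spiral_radius_def power_int_strict_increasing)

text \<open>Stage n holds the spiral vectors n to n + 3. The smallest disk sits at index n + 1
  modulo 4 and is the next to be swapped out, so all stages lie in one orbit.\<close>

fun spiral_quad :: "nat \<Rightarrow> 4 \<Rightarrow> real \<times> complex \<times> real" where
  "spiral_quad 0 = (\<lambda>i. spiral_vec (if i = 1 then 0 else if i = 2 then 1 else if i = 3 then 2 else 3))"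
| "spiral_quad (Suc n) = swap (of_nat n + 1) (spiral_quad n)"

lemma descartes_quad_spiral: "descartes_quad (spiral_quad n)"
proof (induction n)
  case 0
  show ?case
    unfolding descartes_quad_def forall_4 by (simp add: inv_form_spiral_vec)
qed (simp add: descartes_quad_swap)

lemma cyclic_cases_4:
  fixes j k :: 4
  obtains "j = k" | "j = k + 1" | "j = k + 2" | "j = k + 3"
proof -
  have "j = k + (j - k)" by simp
  then show ?thesis using that exhaust_4[of "j - k"] by fastforce
qed

text \<open>Disk n + 4 is tangent to disks n + 1 to n + 3, so its vector is either that of disk n or
  the swap of it; the differing curvatures leave the swap.\<close>

lemma spiral_quad_nth:
  "spiral_quad n (of_nat n + 1) = spiral_vec (int n)"
  "spiral_quad n (of_nat n + 2) = spiral_vec (int n + 1)"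
  "spiral_quad n (of_nat n + 3) = spiral_vec (int n + 2)"
  "spiral_quad n (of_nat n + 4) = spiral_vec (int n + 3)"
proof (induction n)
  case (Suc n)
  define k :: 4 where "k = of_nat n + 1"
  note IH = Suc.IH[folded k_def]
  have k: "of_nat n + 2 = k + 1" "of_nat n + 3 = k + 2" "of_nat n + 4 = k + 3"
    "of_nat (Suc n) + 1 = k + 1" "of_nat (Suc n) + 2 = k + 2" "of_nat (Suc n) + 3 = k + 3"
    "of_nat (Suc n) + 4 = k"
    by (simp_all add: k_def)
  have ne: "k + 1 \<noteq> k" "k + 2 \<noteq> k" "k + 3 \<noteq> k" by simp_all
  have "spiral_vec (int n + 4) = spiral_quad n k \<or> spiral_vec (int n + 4) = swap k (spiral_quad n) k"
  proof (rule tangent_to_three[OF descartes_quad_spiral])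
    fix j assume "j \<noteq> k"
    then show "inv_form (spiral_vec (int n + 4)) (spiral_quad n j) = 1"
      using IH by (cases rule: cyclic_cases_4[of j k]) (simp_all add: k inv_form_spiral_vec)
  qed (simp add: inv_form_spiral_vec)
  moreover have "spiral_vec (int n + 4) \<noteq> spiral_quad n k"
    using fst_spiral_vec_less[of "int n" "int n + 4"] IH by auto
  ultimately have "swap k (spiral_quad n) k = spiral_vec (int n + 4)" by simp
  then show "spiral_quad (Suc n) (of_nat (Suc n) + 1) = spiral_vec (int (Suc n))"
    "spiral_quad (Suc n) (of_nat (Suc n) + 2) = spiral_vec (int (Suc n) + 1)"
    "spiral_quad (Suc n) (of_nat (Suc n) + 3) = spiral_vec (int (Suc n) + 2)"
    "spiral_quad (Suc n) (of_nat (Suc n) + 4) = spiral_vec (int (Suc n) + 3)"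
    using IH ne unfolding spiral_quad.simps k_def[symmetric] k
    by (simp_all add: swap_def algebra_simps)
qed simp_all

lemma orbit_spiral_quad: "orbit (spiral_quad 0) (spiral_quad n)"
  by (induction n) (auto intro: orbit.intros simp del: spiral_quad.simps(1))

text \<open>Every quadruple of the orbit is reached from some \<open>spiral_quad n\<close> by a reduced word that does
  not begin with the step to \<open>spiral_quad (Suc n)\<close>; along such words the curvatures increase.\<close>

inductive spiral_reduced :: "(4 \<Rightarrow> real \<times> complex \<times> real) \<Rightarrow> 4 \<Rightarrow> bool" where
  base: "spiral_reduced (spiral_quad n) (of_nat n + 1)"
| step: "spiral_reduced R l \<Longrightarrow> i \<noteq> l \<Longrightarrow> spiral_reduced (swap i R) i"

lemma orbit_imp_spiral_reduced: "orbit (spiral_quad 0) R \<Longrightarrow> \<exists>l. spiral_reduced R l"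
proof (induction rule: orbit.induct)
  case base
  show ?case using spiral_reduced.base by blast
next
  case (step R i)
  obtain l where l: "spiral_reduced R l" using step.IH ..
  show ?case
  proof (cases "l = i")
    case True
    \<comment> \<open>At a base quadruple the swap at its label leads to the next spiral quadruple,
      again a base; otherwise it cancels the last letter.\<close>
    from l show ?thesis
      unfolding True
    proof cases
      case (base n)
      then show ?thesis using spiral_reduced.base[of "Suc n"] by auto
    qed auto
  next
    case False
    then show ?thesis using spiral_reduced.step[OF l] by metis
  qed
qed

text \<open>By the half-sum bound, a swapped curvature becomes at least the sum of the other three,
  which keeps it positive. In a spiral quadruple the exempt index carries the largest curvature, so
  every other one is at most half the sum.\<close>

lemma spiral_reduced_curvature:
  assumes "spiral_reduced R l"
  shows "(\<forall>i. 0 < fst (R i)) \<and> (\<forall>i. i \<noteq> l \<longrightarrow> 2 * fst (R i) \<le> (\<Sum>j\<in>UNIV. fst (R j)))"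
  using assms
proof induction
  case (base n)
  define k :: 4 where "k = of_nat n + 1"
  have k: "of_nat n + 2 = k + 1" "of_nat n + 3 = k + 2" "of_nat n + 4 = k + 3"
    by (simp_all add: k_def)
  note nth = spiral_quad_nth[of n, folded k_def, unfolded k]
  have pos: "0 < fst (spiral_quad n i)" for i
    using fst_spiral_vec_pos nth by (cases rule: cyclic_cases_4[of i k]) simp_all
  have "2 * fst (spiral_quad n i) \<le> (\<Sum>j\<in>UNIV. fst (spiral_quad n j))" if "i \<noteq> k" for i
  proof -
    have "fst (spiral_quad n i) \<le> fst (spiral_quad n k)"
      using that nth fst_spiral_vec_less[of "int n"]
      by (cases rule: cyclic_cases_4[of i k]) (simp_all add: less_imp_le)
    then have "2 * fst (spiral_quad n i) \<le> (\<Sum>j\<in>{i, k}. fst (spiral_quad n j))"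
      using that by simp
    also have "\<dots> \<le> (\<Sum>j\<in>UNIV. fst (spiral_quad n j))"
      using pos by (intro sum_mono2) (auto simp: less_imp_le)
    finally show ?thesis .
  qed
  then show ?case using pos by (simp add: k_def)
next
  case (step R l i)
  define x where "x j = fst (R j)" for j
  have y: "fst (swap i R j) = (if j = i then 2 * (x 1 + x 2 + x 3 + x 4) - 3 * x i else x j)" for j
    by (simp add: swap_def x_def fst_sum sum_4)
  have p: "0 < x 1" "0 < x 2" "0 < x 3" "0 < x 4" and m: "2 * x i \<le> x 1 + x 2 + x 3 + x 4"
    using step.IH step.hyps by (simp_all add: x_def sum_4)
  show ?case
    using exhaust_4[of i] p m unfolding forall_4 sum_4 y by auto
qed

lemma orbit_spiral_curvature_pos: "\<forall>R i. orbit (spiral_quad 0) R \<longrightarrow> 0 < fst (R i)"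
proof (intro allI impI)
  fix R i assume "orbit (spiral_quad 0) R"
  then obtain l where "spiral_reduced R l" using orbit_imp_spiral_reduced by blast
  then show "0 < fst (R i)" using spiral_reduced_curvature by blast
qed

text \<open>The stages supply the nonnegative indices only. Going backwards, disk m is inscribed
  between disks m + 1 to m + 3, which is why the induction carries three consecutive disks.\<close>

lemma spiral_disk_in_orbit_disks: "spiral_disk n \<in> orbit_disks (spiral_quad 0)"
proof -
  have pos: "spiral_disk (int n) \<in> orbit_disks (spiral_quad 0)" for n
    unfolding spiral_disk_def
    by (rule orbit_disksI[OF orbit_spiral_quad spiral_radius_pos, of n "of_nat n + 1"])
      (simp only: spiral_quad_nth spiral_vec_def)
  have neg: "spiral_disk (- int n) \<in> orbit_disks (spiral_quad 0) \<and>
    spiral_disk (- int n + 1) \<in> orbit_disks (spiral_quad 0) \<and>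
    spiral_disk (- int n + 2) \<in> orbit_disks (spiral_quad 0)" for n
  proof (induction n)
    case 0
    show ?case using pos[of 0] pos[of 1] pos[of 2] by simp
  next
    case (Suc n)
    define m where "m = - int (Suc n)"
    have m: "- int n = m + 1" "- int n + 1 = m + 2" "- int n + 2 = m + 3"
      by (simp_all add: m_def)
    have IH: "spiral_disk (m + 1) \<in> orbit_disks (spiral_quad 0)"
      "spiral_disk (m + 2) \<in> orbit_disks (spiral_quad 0)"
      "spiral_disk (m + 3) \<in> orbit_disks (spiral_quad 0)"
      using Suc.IH unfolding m[symmetric] by blast+
    have "spiral_disk m \<in> orbit_disks (spiral_quad 0)"
      by (rule orbit_disks_inscribe[OF descartes_quad_spiral orbit_spiral_curvature_pos IH])
        (simp_all add: mutually_tangent_def tangent_spiral_disk generalized_spiral_disk)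
    with IH show ?case
      unfolding m_def[symmetric] by blast
  qed
  show ?thesis
    using pos neg by (cases n rule: int_cases2) blast+
qed

theorem theorem2:
  shows "of_real rho * omega = (1 + of_real (sqrt tau)) * (- 1 + of_real (sqrt phi) * \<i>) \<and>
    (\<forall>n::int. descartes_configuration
       (spiral_disk n) (spiral_disk (n + 1)) (spiral_disk (n + 2)) (spiral_disk (n + 3))) \<and>
    (\<exists>P. apollonian_packing P \<and> unbounded_packing P \<and>
       (\<forall>n::int. spiral_disk n \<in> P) \<and>
       fills_plane_with_positive_curvature P)"
proof (intro conjI exI[of _ "orbit_disks (spiral_quad 0)"] allI)
  show "of_real rho * omega = (1 + of_real (sqrt tau)) * (- 1 + of_real (sqrt phi) * \<i>)"
    by (rule rho_omega_eq)
  show "descartes_configuration (spiral_disk n) (spiral_disk (n + 1)) (spiral_disk (n + 2)) (spiral_disk (n + 3))" for n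
    by (simp add: descartes_configuration_def generalized_spiral_disk tangent_spiral_disk)
  \<comment> \<open>Any three consecutive disks of the spiral could be the seed; these are the first
    three members of stage 0.\<close>
  have "packing_of_seed (spiral_disk 0) (spiral_disk 1) (spiral_disk 2) = orbit_disks (spiral_quad 0)"
    unfolding spiral_disk_def
    by (rule packing_of_seed_eq_orbit_disks[OF descartes_quad_spiral orbit_spiral_curvature_pos])
      (simp_all add: spiral_vec_def spiral_radius_pos)
  then show "apollonian_packing (orbit_disks (spiral_quad 0))"
    unfolding apollonian_packing_def
    by (intro exI[of _ "spiral_disk 0"] exI[of _ "spiral_disk 1"] exI[of _ "spiral_disk 2"])
      (simp add: generalized_spiral_disk mutually_tangent_def tangent_spiral_disk)
  show "spiral_disk n \<in> orbit_disks (spiral_quad 0)" for n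
    by (rule spiral_disk_in_orbit_disks)
  show "unbounded_packing (orbit_disks (spiral_quad 0))"
    unfolding unbounded_packing_def
  proof
    fix x
    obtain n where "x < rho ^ n" using real_arch_pow[OF rho_gt_1] by blast
    then have "x < spiral_radius (int n)"
      by (simp add: spiral_radius_def)
    moreover have "has_radius (spiral_disk (int n)) (spiral_radius (int n))"
      unfolding spiral_disk_def by (rule has_radius.intros(1)[OF spiral_radius_pos])
    ultimately show "\<exists>D\<in>orbit_disks (spiral_quad 0). \<exists>r. has_radius D r \<and> x < r"
      using spiral_disk_in_orbit_disks by blast
  qed
  show "fills_plane_with_positive_curvature (orbit_disks (spiral_quad 0))"
    by (rule fills_plane_orbit_disks[OF descartes_quad_spiral orbit_spiral_curvature_pos])
qed

end
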